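(* Let $K=2$ and suppose that the points are generated according to the stochastic ball model in $\mathbb{R}^m$, with $n/2$ points in each of the two clusters ($n$ even) and with distance $\Delta$ between the two ball centers. If $\Delta > 1+\sqrt{3}$, then the linear program (LP2) given in the context recovers the planted clusters with high probability; that is, with probability tending to $1$ as $n\to\infty$, the unique optimal solution of (LP2) is the matrix $\bar X$ of the planted clusters.
   Context: Notation: $[n]=\{1,\dots,n\}$. Stochastic ball model (SBM) with two clusters: let $\gamma^1,\gamma^2\in\mathbb{R}^m$ be the ball centers and $\Delta=\|\gamma^1-\gamma^2\|_2$. For each $k\in\{1,2\}$ draw i.i.d. vectors $y^{k,1},\dots,y^{k,n/2}$ (independently across the two clusters) from some rotation-invariant distribution supported on the unit ball of $\mathbb{R}^m$. The points of cluster $k$ are $x^{k,i}=y^{k,i}+\gamma^k$. The dimension $m$, the distribution and the centers are fixed while $n\to\infty$. List the $n$ points as $x^1,\dots,x^n$, with the points of the first cluster indexed by $\mathcal{C}_1=\{1,\dots,n/2\}$ and those of the second cluster by $\mathcal{C}_2=\{n/2+1,\dots,n\}$. Let $d_{ij}=\|x^i-x^j\|_2^2$. (LP2) is the following linear program in the entries of a symmetric matrix $X\in\mathbb{R}^{n\times n}$ ($X_{ij}=X_{ji}$): $$\min \sum_{i,j\in[n]} d_{ij}X_{ij}\quad\text{s.t.}\quad \operatorname{Tr}(X)=2,\quad \sum_{j=1}^n X_{ij}=1\ \ \forall i\in[n],\quad X_{ij}+X_{ik}\le X_{ii}+X_{jk}\ \ \forall \text{ distinct } i,j,k\in[n].$$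 The matrix of the planted clusters is $\bar X$ with $\bar X_{ij}=2/n$ if $i,j$ belong to the same set among $\mathcal{C}_1,\mathcal{C}_2$ (including $i=j$), and $\bar X_{ij}=0$ otherwise. An optimization problem recovers the planted clusters if its unique optimal solution corresponds to the planted clusters. "With high probability" means with probability tending to one as $n\to\infty$. *)

theory Defs
  imports "HOL-Probability.Probability"
begin

(* Rotations are taken in the full orthogonal group.  In dimension at least 2 this gives the same
   class of distributions as the special orthogonal group; in dimension 1 it means symmetry
   about 0, whereas the special orthogonal group would impose nothing. *)
definition rotation_invariant :: "(real ^ 'm) measure \<Rightarrow> bool" where
  "rotation_invariant D \<longleftrightarrow> (\<forall>f. orthogonal_transformation f \<longrightarrow> distr D borel f = D)"

definition ball_distribution :: "(real ^ 'm) measure \<Rightarrow> bool" where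
  "ball_distribution D \<longleftrightarrow>
     prob_space D \<and> sets D = sets borel \<and> rotation_invariant D \<and> (AE z in D. z \<in> cball 0 1)"

definition sbm_draws ::
  "'a measure \<Rightarrow> (real ^ 'm) measure \<Rightarrow> nat \<Rightarrow> (nat \<Rightarrow> nat \<Rightarrow> 'a \<Rightarrow> real ^ 'm) \<Rightarrow> bool" where
  "sbm_draws M D N y \<longleftrightarrow>
     prob_space M \<and>
     prob_space.indep_vars M (\<lambda>_. borel) (\<lambda>(k, i). y k i) ({1, 2} \<times> {1..N}) \<and>
     (\<forall>k\<in>{1, 2}. \<forall>i\<in>{1..N}. distr M borel (y k i) = D)"

definition sbm_point ::
  "(nat \<Rightarrow> real ^ 'm) \<Rightarrow> nat \<Rightarrow> (nat \<Rightarrow> nat \<Rightarrow> 'a \<Rightarrow> real ^ 'm) \<Rightarrow> 'a \<Rightarrow> nat \<Rightarrow> real ^ 'm" where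
  "sbm_point \<gamma> N y \<omega> i = (if i \<le> N then y 1 i \<omega> + \<gamma> 1 else y 2 (i - N) \<omega> + \<gamma> 2)"

definition sq_dist :: "(nat \<Rightarrow> real ^ 'm) \<Rightarrow> nat \<Rightarrow> nat \<Rightarrow> real" where
  "sq_dist x i j = (norm (x i - x j))\<^sup>2"

(* An n-by-n matrix is a function on nat * nat of which only the entries with both indices
   in {1..n} matter; optimal solutions are therefore compared on these entries only. *)
definition lp2_feasible :: "nat \<Rightarrow> (nat \<Rightarrow> nat \<Rightarrow> real) \<Rightarrow> bool" where
  "lp2_feasible n X \<longleftrightarrow>
     (\<forall>i\<in>{1..n}. \<forall>j\<in>{1..n}. X i j = X j i) \<and>
     (\<Sum>i=1..n. X i i) = 2 \<and>
     (\<forall>i\<in>{1..n}. (\<Sum>j=1..n. X i j) = 1) \<and>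
     (\<forall>i\<in>{1..n}. \<forall>j\<in>{1..n}. \<forall>k\<in>{1..n}. i \<noteq> j \<and> i \<noteq> k \<and> j \<noteq> k \<longrightarrow>
        X i j + X i k \<le> X i i + X j k)"

definition lp2_objective :: "nat \<Rightarrow> (nat \<Rightarrow> nat \<Rightarrow> real) \<Rightarrow> (nat \<Rightarrow> nat \<Rightarrow> real) \<Rightarrow> real" where
  "lp2_objective n d X = (\<Sum>i=1..n. \<Sum>j=1..n. d i j * X i j)"

definition lp2_optimal :: "nat \<Rightarrow> (nat \<Rightarrow> nat \<Rightarrow> real) \<Rightarrow> (nat \<Rightarrow> nat \<Rightarrow> real) \<Rightarrow> bool" where
  "lp2_optimal n d X \<longleftrightarrow>
     lp2_feasible n X \<and> (\<forall>Y. lp2_feasible n Y \<longrightarrow> lp2_objective n d X \<le> lp2_objective n d Y)"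

definition planted_cluster :: "nat \<Rightarrow> nat \<Rightarrow> nat set" where
  "planted_cluster n k = (if k = 1 then {1..n div 2} else {n div 2 + 1..n})"

definition planted_matrix :: "nat \<Rightarrow> nat \<Rightarrow> nat \<Rightarrow> real" where
  "planted_matrix n i j =
     (if \<exists>k\<in>{1, 2}. i \<in> planted_cluster n k \<and> j \<in> planted_cluster n k then 2 / real n else 0)"

definition lp2_recovers :: "nat \<Rightarrow> (nat \<Rightarrow> nat \<Rightarrow> real) \<Rightarrow> bool" where
  "lp2_recovers n d \<longleftrightarrow>
     lp2_optimal n d (planted_matrix n) \<and>
     (\<forall>X. lp2_optimal n d X \<longrightarrow> (\<forall>i\<in>{1..n}. \<forall>j\<in>{1..n}. X i j = planted_matrix n i j))"

end

theory Submission imports Defs begin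

text \<open>The heart of the proof is a deterministic statement, \<open>lp2_recovers_if_separated\<close>: if the
points of two clusters of equal size lie within distance \<open>R\<close> of the centroids of their clusters, and
the centroids are more than \<open>(1 + sqrt 3) * R\<close> apart, then the planted matrix is the unique optimum.
In the stochastic ball model the points almost surely lie within distance 1 of the ball centres, and by Hoeffding's
inequality the centroids converge to the ball centres in probability. Since the hypothesis on the
distance is strict, it survives this small perturbation.

The deterministic statement is proved by linear programming duality. Measure the points by their
differences \<open>z i\<close> to the centroids; this makes the sum of the \<open>z i\<close> over each cluster exactly zero, so no
approximation is needed. Among the triangle constraints that are tight at the planted matrix only those
with \<open>i, j\<close> in one cluster and \<open>k\<close> in the other are used. The objective is a constant plus a
combination of their slacks with explicit multipliers (\<open>objective_eq_const_plus_slacks\<close>). Once all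
multipliers are positive, the planted matrix is optimal; at any other optimum the
same slacks vanish, which forces it to be the planted matrix (\<open>tight_slacks_imp_planted\<close>).

The multipliers arise as follows. The coefficients of the entries across the clusters must be produced
by differences of multipliers, that is by a flow between the points of one cluster for each point of the
other; the sum of the multipliers available for a pair inside a cluster is prescribed by their distance.
Positivity therefore asks that the total absolute flow between two points of a cluster be less than this
prescribed amount, which is the inequality \<open>sum_abs_projection_less\<close>; the constant \<open>1 + sqrt 3\<close> is
what its extreme case requires.

The probability of recovery only makes sense as intended if recovery is an event. This is
\<open>sets_lp2_recovers\<close>, a compactness argument on the feasible set.\<close>

section \<open>Weighted sums of triangle slacks\<close>

lemma sum_antisymmetric_eq_0:
  fixes g :: "'i \<Rightarrow> 'i \<Rightarrow> real"
  assumes "\<And>i j. i \<in> A \<Longrightarrow> j \<in> A \<Longrightarrow> g i j = - g j i"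
  shows "(\<Sum>i\<in>A. \<Sum>j\<in>A. g i j) = 0"
proof -
  have "(\<Sum>i\<in>A. \<Sum>j\<in>A. g i j) = (\<Sum>i\<in>A. \<Sum>j\<in>A. - g j i)"
    using assms by (intro sum.cong refl)
  also have "\<dots> = - (\<Sum>i\<in>A. \<Sum>j\<in>A. g i j)"
    by (subst sum.swap) (simp add: sum_negf)
  finally show ?thesis by simp
qed

definition triangle_slack :: "('i \<Rightarrow> 'i \<Rightarrow> real) \<Rightarrow> 'i \<Rightarrow> 'i \<Rightarrow> 'i \<Rightarrow> real" where
  "triangle_slack X i j k = X i i + X j k - X i j - X i k"

text \<open>With \<open>i\<close> and \<open>j\<close> in one cluster and \<open>k\<close> in the other, the weight of the slack of \<open>(i; j, k)\<close> is split
into a part \<open>s\<close> symmetric in \<open>i, j\<close> and a part \<open>f\<close> antisymmetric in them. Summed over both orders of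
\<open>i, j\<close>, the part \<open>s\<close> only sees entries of \<open>X\<close> inside the cluster, while \<open>f\<close> acts as a flow between the
rows \<open>i\<close> and \<open>j\<close> of column \<open>k\<close>; its net outflow \<open>p\<close> is the coefficient that it puts on the entries
across the clusters.\<close>

lemma sum_flow_times_slack:
  fixes X :: "'i \<Rightarrow> 'i \<Rightarrow> real"
  assumes X: "\<And>i j. i \<in> A \<Longrightarrow> j \<in> A \<Longrightarrow> X i j = X j i"
    and s: "\<And>i j k. s i j k = s j i k"
    and f: "\<And>i j k. f i j k = - f j i k"
    and m: "\<And>i j. (\<Sum>k\<in>B. s i j k) = m i j"
    and p: "\<And>i k. i \<in> A \<Longrightarrow> k \<in> B \<Longrightarrow> (\<Sum>j\<in>A. f i j k) = p i k"
  shows "(\<Sum>i\<in>A. \<Sum>j\<in>A. \<Sum>k\<in>B. (s i j k - f i j k) / 2 * triangle_slack X i j k) =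
    (\<Sum>i\<in>A. \<Sum>j\<in>A. m i j / 2 * (X i i - X i j)) + (\<Sum>i\<in>A. \<Sum>k\<in>B. p i k * (X i k - X i i / 2))"
proof -
  define L where "L i j k = (s i j k - f i j k) / 2 * triangle_slack X i j k" for i j k
  define R where "R i j k = s i j k / 2 * (X i i - X i j) + f i j k * (X i k - X i i / 2)" for i j k
  have "(\<Sum>i\<in>A. \<Sum>j\<in>A. \<Sum>k\<in>B. L i j k - R i j k) = 0"
  proof (rule sum_antisymmetric_eq_0)
    fix i j assume ij: "i \<in> A" "j \<in> A"
    have "L i j k - R i j k = - (L j i k - R j i k)" for k
      using X[OF ij] s[of j i k] f[of j i k]
      by (simp add: L_def R_def triangle_slack_def field_simps)
    then show "(\<Sum>k\<in>B. L i j k - R i j k) = - (\<Sum>k\<in>B. L j i k - R j i k)"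
      unfolding sum_negf[symmetric] by (intro sum.cong refl)
  qed
  then have "(\<Sum>i\<in>A. \<Sum>j\<in>A. \<Sum>k\<in>B. L i j k) = (\<Sum>i\<in>A. \<Sum>j\<in>A. \<Sum>k\<in>B. R i j k)"
    by (simp add: sum_subtractf)
  also have "\<dots> = (\<Sum>i\<in>A. \<Sum>j\<in>A. (\<Sum>k\<in>B. s i j k) / 2 * (X i i - X i j)) +
      (\<Sum>i\<in>A. \<Sum>j\<in>A. \<Sum>k\<in>B. f i j k * (X i k - X i i / 2))"
    by (simp add: R_def sum.distrib sum_distrib_right sum_divide_distrib)
  also have "(\<Sum>i\<in>A. \<Sum>j\<in>A. \<Sum>k\<in>B. f i j k * (X i k - X i i / 2)) =
      (\<Sum>i\<in>A. \<Sum>k\<in>B. (\<Sum>j\<in>A. f i j k) * (X i k - X i i / 2))"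
    by (subst sum.swap[of _ B A]) (simp add: sum_distrib_right)
  also have "\<dots> = (\<Sum>i\<in>A. \<Sum>k\<in>B. p i k * (X i k - X i i / 2))"
    using p by (intro sum.cong refl) simp
  finally show ?thesis by (simp add: L_def m)
qed

text \<open>Twice the difference \<open>u i + u j - d\<close>, where \<open>d\<close> is the squared distance of the points \<open>z i\<close> and \<open>z j\<close>
of one cluster, and \<open>u i = (norm (z i))\<^sup>2 + z i \<bullet> \<delta> + (\<delta> \<bullet> \<delta>) / 2\<close> is the potential of the row \<open>i\<close>
(the part of the dual solution that belongs to the row-sum constraint). Here \<open>z\<close> gives the points relative to the centroids of their
clusters, and \<open>\<delta>\<close> points from the other centroid to that of the cluster under consideration.\<close>

definition gap :: "('i \<Rightarrow> 'v::real_inner) \<Rightarrow> 'v \<Rightarrow> 'i \<Rightarrow> 'i \<Rightarrow> real" where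
  "gap z \<delta> i j = 2 * (\<delta> \<bullet> \<delta> + (z i + z j) \<bullet> \<delta> + 2 * (z i \<bullet> z j))"

text \<open>The flow that equalises the potentials \<open>2 * (z i \<bullet> (\<delta> - z k))\<close> over the cluster of \<open>i\<close>. The cross
term of the squared distances is bilinear in \<open>z i\<close> and \<open>z k\<close>; half of it is carried by this flow and
half by the flow of the other cluster.\<close>

definition flow :: "('i \<Rightarrow> 'v::real_inner) \<Rightarrow> 'v \<Rightarrow> 'i set \<Rightarrow> 'i \<Rightarrow> 'i \<Rightarrow> 'i \<Rightarrow> real" where
  "flow z \<delta> B i j k = 2 * ((z i - z j) \<bullet> (\<delta> - z k)) / real (card B)"

text \<open>Half of \<open>s - f\<close> in the splitting of \<open>sum_flow_times_slack\<close>, where \<open>f\<close> is the flow and \<open>s\<close> is the absolute value of \<open>f\<close>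
plus the unused part of the gap, spread evenly over the other cluster.\<close>

definition multiplier :: "('i \<Rightarrow> 'v::real_inner) \<Rightarrow> 'v \<Rightarrow> 'i set \<Rightarrow> 'i \<Rightarrow> 'i \<Rightarrow> 'i \<Rightarrow> real" where
  "multiplier z \<delta> B i j k =
    (\<bar>flow z \<delta> B i j k\<bar> + (gap z \<delta> i j - (\<Sum>l\<in>B. \<bar>flow z \<delta> B i j l\<bar>)) / real (card B)
      - flow z \<delta> B i j k) / 2"

lemma half_gap: "gap z \<delta> i j / 2 = \<delta> \<bullet> \<delta> + z i \<bullet> \<delta> + z j \<bullet> \<delta> + 2 * (z i \<bullet> z j)"
  by (simp add: gap_def inner_add_left)

lemma sum_multiplier_times_slack:
  fixes X :: "'i \<Rightarrow> 'i \<Rightarrow> real" and z :: "'i \<Rightarrow> 'v::real_inner"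
  assumes "finite A" "finite B" "card A = N" "card B = N" "N > 0"
    and zA: "(\<Sum>i\<in>A. z i) = 0" and zB: "(\<Sum>k\<in>B. z k) = 0"
    and X: "\<And>i j. i \<in> A \<Longrightarrow> j \<in> A \<Longrightarrow> X i j = X j i"
  shows "(\<Sum>i\<in>A. \<Sum>j\<in>A. \<Sum>k\<in>B. multiplier z \<delta> B i j k * triangle_slack X i j k) =
    real N * (\<delta> \<bullet> \<delta>) * (\<Sum>i\<in>A. X i i)
    - (\<Sum>i\<in>A. \<Sum>j\<in>A. gap z \<delta> i j / 2 * X i j)
    + (\<Sum>i\<in>A. \<Sum>k\<in>B. 2 * (z i \<bullet> (\<delta> - z k)) * X i k)"
proof -
  define s where "s i j k = \<bar>flow z \<delta> B i j k\<bar> +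
    (gap z \<delta> i j - (\<Sum>l\<in>B. \<bar>flow z \<delta> B i j l\<bar>)) / real (card B)" for i j k
  define p where "p i k = 2 * (z i \<bullet> (\<delta> - z k))" for i k
  have flow_anti: "flow z \<delta> B i j k = - flow z \<delta> B j i k" for i j k
    by (simp add: flow_def inner_diff_left diff_divide_distrib right_diff_distrib)
  have "gap z \<delta> i j = gap z \<delta> j i" for i j
    by (simp add: gap_def inner_commute add.commute)
  moreover have "\<bar>flow z \<delta> B i j k\<bar> = \<bar>flow z \<delta> B j i k\<bar>" for i j k
    by (subst flow_anti) simp
  ultimately have s_sym: "s i j k = s j i k" for i j k
    by (simp add: s_def)
  have s_sum: "(\<Sum>k\<in>B. s i j k) = gap z \<delta> i j" for i j
    using assms by (simp add: s_def sum.distrib)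
  have flow_sum: "(\<Sum>j\<in>A. flow z \<delta> B i j k) = p i k" for i k
  proof -
    have "(\<Sum>j\<in>A. flow z \<delta> B i j k) = 2 * ((\<Sum>j\<in>A. z i - z j) \<bullet> (\<delta> - z k)) / N"
      using assms by (simp add: flow_def inner_sum_left sum_distrib_left sum_divide_distrib)
    also have "(\<Sum>j\<in>A. z i - z j) = real N *\<^sub>R z i"
      using assms by (simp add: sum_subtractf sum_constant_scaleR)
    finally show ?thesis using assms by (simp add: p_def)
  qed
  have "(\<Sum>i\<in>A. \<Sum>j\<in>A. \<Sum>k\<in>B. multiplier z \<delta> B i j k * triangle_slack X i j k) =
    (\<Sum>i\<in>A. \<Sum>j\<in>A. gap z \<delta> i j / 2 * (X i i - X i j)) + (\<Sum>i\<in>A. \<Sum>k\<in>B. p i k * (X i k - X i i / 2))"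
    unfolding multiplier_def s_def[symmetric]
    by (rule sum_flow_times_slack[OF X s_sym flow_anti s_sum flow_sum])
  also have "\<dots> = (\<Sum>i\<in>A. ((\<Sum>j\<in>A. gap z \<delta> i j / 2) - (\<Sum>k\<in>B. p i k) / 2) * X i i)
    - (\<Sum>i\<in>A. \<Sum>j\<in>A. gap z \<delta> i j / 2 * X i j) + (\<Sum>i\<in>A. \<Sum>k\<in>B. p i k * X i k)"
    by (simp add: right_diff_distrib sum_subtractf sum_distrib_left sum_distrib_right
        sum_divide_distrib diff_divide_distrib algebra_simps)
  also have "(\<Sum>i\<in>A. ((\<Sum>j\<in>A. gap z \<delta> i j / 2) - (\<Sum>k\<in>B. p i k) / 2) * X i i) =
    (\<Sum>i\<in>A. real N * (\<delta> \<bullet> \<delta>) * X i i)"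
  proof (intro sum.cong refl)
    fix i
    have "(\<Sum>j\<in>A. gap z \<delta> i j / 2) =
        N * (\<delta> \<bullet> \<delta> + z i \<bullet> \<delta>) + (\<Sum>j\<in>A. z j) \<bullet> \<delta> + 2 * (z i \<bullet> (\<Sum>j\<in>A. z j))"
      unfolding half_gap using assms(3)
      by (simp add: sum.distrib inner_sum_left inner_sum_right sum_distrib_left)
    moreover have "(\<Sum>k\<in>B. p i k) = 2 * N * (z i \<bullet> \<delta>) - 2 * (z i \<bullet> (\<Sum>k\<in>B. z k))"
      using assms(4)
      by (simp add: p_def inner_diff_right sum_subtractf right_diff_distrib inner_sum_right
          sum_distrib_left)
    ultimately show "((\<Sum>j\<in>A. gap z \<delta> i j / 2) - (\<Sum>k\<in>B. p i k) / 2) * X i i =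
        real N * (\<delta> \<bullet> \<delta>) * X i i"
      using zA zB by (simp add: algebra_simps)
  qed
  finally show ?thesis by (simp add: p_def sum_distrib_left)
qed

text \<open>This inequality makes the multipliers positive, and it is where \<open>1 + sqrt 3\<close> enters. Put \<open>v = u - w\<close>.
If \<open>v \<bullet> \<delta>\<close> dominates every \<open>v \<bullet> z k\<close>, all terms on the left have the same sign and, since the \<open>z k\<close>
sum to zero, the average is exactly \<open>\<bar>v \<bullet> \<delta>\<bar>\<close>; say \<open>v \<bullet> \<delta> \<ge> 0\<close>. What remains is
\<open>\<delta> \<bullet> \<delta> + 2 * (w \<bullet> \<delta>) + 2 * (u \<bullet> w) > 0\<close>. The worst \<open>w\<close> points against \<open>\<delta>\<close> with norm \<open>R\<close>, and the
worst \<open>u\<close> is \<open>-w\<close>, which gives \<open>(norm \<delta>)\<^sup>2 - 2 * R * norm \<delta> - 2 * R\<^sup>2 > 0\<close>; the positive root is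
\<open>(1 + sqrt 3) * R\<close>. In the other case \<open>v\<close> is nearly orthogonal to \<open>\<delta>\<close>, and there is enough room for
the crude bound \<open>2 * R * norm v\<close> on each term.\<close>

lemma sum_abs_projection_less:
  fixes z :: "'i \<Rightarrow> 'v::real_inner"
  assumes "finite B" "card B > 0" and zB: "(\<Sum>k\<in>B. z k) = 0"
    and zR: "\<And>k. k \<in> B \<Longrightarrow> norm (z k) \<le> R"
    and u: "norm u \<le> R" and w: "norm w \<le> R"
    and \<delta>: "norm \<delta> > (1 + sqrt 3) * R"
  shows "(\<Sum>k\<in>B. \<bar>(u - w) \<bullet> (\<delta> - z k)\<bar>) <
    real (card B) * (\<delta> \<bullet> \<delta> + (u + w) \<bullet> \<delta> + 2 * (u \<bullet> w))"
proof -
  define v where "v = u - w"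
  define D where "D = norm \<delta>"
  have R0: "R \<ge> 0" using u norm_ge_zero order_trans by blast
  have uw: "u \<bullet> w \<ge> - R\<^sup>2"
  proof -
    have "\<bar>u \<bullet> w\<bar> \<le> norm u * norm w" by (rule Cauchy_Schwarz_ineq2)
    also have "\<dots> \<le> R * R" using u w R0 by (intro mult_mono) auto
    finally show ?thesis by (simp add: power2_eq_square)
  qed
  have dd: "\<delta> \<bullet> \<delta> = D\<^sup>2" by (simp add: D_def power2_norm_eq_inner)
  have D: "D > (1 + sqrt 3) * R" using \<delta> by (simp add: D_def)
  have D0: "D > 0" using D R0 by (smt (verit) mult_nonneg_nonneg real_sqrt_ge_zero)
  have "D - R > sqrt 3 * R" using D by (simp add: algebra_simps)
  then have "(D - R)\<^sup>2 > (sqrt 3 * R)\<^sup>2"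
    using R0 by (intro power_strict_mono) auto
  then have key: "D\<^sup>2 - 2 * R * D - 2 * R\<^sup>2 > 0"
    by (simp add: power_mult_distrib power2_eq_square algebra_simps)
  have bd: "\<bar>a \<bullet> \<delta>\<bar> \<le> R * D" if "norm a \<le> R" for a
    using Cauchy_Schwarz_ineq2[of a \<delta>] that D0 unfolding D_def
    by (smt (verit) mult_right_mono norm_ge_zero)
  show ?thesis
  proof (cases "norm v * R \<le> \<bar>v \<bullet> \<delta>\<bar>")
    case True
    have le: "\<bar>v \<bullet> z k\<bar> \<le> \<bar>v \<bullet> \<delta>\<bar>" if "k \<in> B" for k
      using Cauchy_Schwarz_ineq2[of v "z k"] zR[OF that] True
      by (smt (verit) mult_left_mono norm_ge_zero)
    have "(\<Sum>k\<in>B. \<bar>v \<bullet> (\<delta> - z k)\<bar>) = (\<Sum>k\<in>B. \<bar>v \<bullet> \<delta>\<bar> - sgn (v \<bullet> \<delta>) * (v \<bullet> z k))"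
    proof (rule sum.cong[OF refl])
      fix k assume "k \<in> B"
      from le[OF this] show "\<bar>v \<bullet> (\<delta> - z k)\<bar> = \<bar>v \<bullet> \<delta>\<bar> - sgn (v \<bullet> \<delta>) * (v \<bullet> z k)"
        by (auto simp: inner_diff_right sgn_if abs_if split: if_splits)
    qed
    also have "\<dots> = card B * \<bar>v \<bullet> \<delta>\<bar> - sgn (v \<bullet> \<delta>) * (v \<bullet> (\<Sum>k\<in>B. z k))"
      by (simp add: sum_subtractf inner_sum_right sum_distrib_left)
    also have "\<dots> = card B * \<bar>v \<bullet> \<delta>\<bar>" using zB by simp
    also have "\<dots> < real (card B) * (\<delta> \<bullet> \<delta> + (u + w) \<bullet> \<delta> + 2 * (u \<bullet> w))"
    proof (rule mult_strict_left_mono)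
      show "\<bar>v \<bullet> \<delta>\<bar> < \<delta> \<bullet> \<delta> + (u + w) \<bullet> \<delta> + 2 * (u \<bullet> w)"
        using bd[OF u] bd[OF w] uw key
        by (simp add: v_def dd inner_diff_left inner_add_left abs_if algebra_simps split: if_splits)
    qed (use assms in simp)
    finally show ?thesis by (simp add: v_def)
  next
    case False
    \<comment> \<open>Everything is expressed in \<open>a\<close>, \<open>norm v\<close> and \<open>D\<close>. After \<open>a\<^sup>2 + (norm v)\<^sup>2 \<le> 4 * R\<^sup>2\<close>, two
      completed squares reduce the claim to \<open>5/6 * D\<^sup>2 > 6 * R\<^sup>2\<close>, and \<open>(1 + sqrt 3)\<^sup>2 > 36/5\<close>.\<close>
    define a where "a = norm (u + w)"
    have par: "a\<^sup>2 + (norm v)\<^sup>2 = 2 * ((norm u)\<^sup>2 + (norm w)\<^sup>2)"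
      by (simp add: a_def v_def power2_norm_eq_inner inner_diff_left inner_diff_right
          inner_add_left inner_add_right inner_commute algebra_simps)
    have "(norm u)\<^sup>2 \<le> R\<^sup>2" "(norm w)\<^sup>2 \<le> R\<^sup>2" using u w by (auto intro: power_mono)
    with par have par4: "a\<^sup>2 + (norm v)\<^sup>2 \<le> 4 * R\<^sup>2" by simp
    have uw2: "2 * (u \<bullet> w) = (a\<^sup>2 - (norm v)\<^sup>2) / 2"
      by (simp add: a_def v_def power2_norm_eq_inner inner_diff_left inner_diff_right
          inner_add_left inner_add_right inner_commute algebra_simps)
    have "\<bar>(u + w) \<bullet> \<delta>\<bar> \<le> a * D" unfolding a_def D_def by (rule Cauchy_Schwarz_ineq2)
    have "(\<Sum>k\<in>B. \<bar>v \<bullet> (\<delta> - z k)\<bar>) \<le> (\<Sum>k\<in>B. 2 * R * norm v)"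
    proof (rule sum_mono)
      fix k assume k: "k \<in> B"
      have "\<bar>v \<bullet> z k\<bar> \<le> norm v * R"
        using Cauchy_Schwarz_ineq2[of v "z k"] zR[OF k]
        by (smt (verit) mult_left_mono norm_ge_zero)
      then show "\<bar>v \<bullet> (\<delta> - z k)\<bar> \<le> 2 * R * norm v"
        using False by (simp add: inner_diff_right algebra_simps)
    qed
    also have "\<dots> = card B * (2 * R * norm v)" by simp
    also have "\<dots> < real (card B) * (\<delta> \<bullet> \<delta> + (u + w) \<bullet> \<delta> + 2 * (u \<bullet> w))"
    proof (rule mult_strict_left_mono)
      have "2 * R * norm v \<le> 2 * R\<^sup>2 + (norm v)\<^sup>2 / 2"
        using zero_le_power2[of "norm v - 2 * R"] by (simp add: power2_eq_square algebra_simps)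
      moreover have "a * D \<le> D\<^sup>2 / 6 + 3 / 2 * a\<^sup>2"
        using zero_le_power2[of "3 * a - D"] by (simp add: power2_eq_square algebra_simps)
      moreover have "5 * D\<^sup>2 > 36 * R\<^sup>2"
      proof -
        have "5/3 \<le> sqrt 3" by (rule real_le_rsqrt) (simp add: power2_eq_square)
        then have "36/5 \<le> (1 + sqrt 3)\<^sup>2" by (simp add: power2_sum)
        then have "36/5 * R\<^sup>2 \<le> (1 + sqrt 3)\<^sup>2 * R\<^sup>2" by (rule mult_right_mono) simp
        also have "\<dots> = ((1 + sqrt 3) * R)\<^sup>2" by (simp add: power_mult_distrib)
        also have "\<dots> < D\<^sup>2" using D R0 by (intro power_strict_mono) auto
        finally show ?thesis by simp
      qed
      ultimately show "2 * R * norm v < \<delta> \<bullet> \<delta> + (u + w) \<bullet> \<delta> + 2 * (u \<bullet> w)"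
        using \<open>\<bar>(u + w) \<bullet> \<delta>\<bar> \<le> a * D\<close> par4 unfolding dd uw2 by (simp add: abs_le_iff) argo
    qed (use assms in simp)
    finally show ?thesis by (simp add: v_def)
  qed
qed

lemma multiplier_pos:
  fixes z :: "'i \<Rightarrow> 'v::real_inner"
  assumes "finite B" "card B > 0" and zB: "(\<Sum>k\<in>B. z k) = 0"
    and zR: "\<And>k. k \<in> B \<Longrightarrow> norm (z k) \<le> R"
    and u: "norm (z i) \<le> R" and w: "norm (z j) \<le> R"
    and \<delta>: "norm \<delta> > (1 + sqrt 3) * R"
  shows "multiplier z \<delta> B i j k > 0"
proof -
  have "(\<Sum>l\<in>B. \<bar>flow z \<delta> B i j l\<bar>) = 2 * (\<Sum>l\<in>B. \<bar>(z i - z j) \<bullet> (\<delta> - z l)\<bar>) / card B"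
    by (simp add: flow_def abs_mult sum_distrib_left sum_divide_distrib)
  also have "\<dots> < gap z \<delta> i j"
    using sum_abs_projection_less[OF assms] assms(2) by (simp add: gap_def field_simps)
  finally have *: "(gap z \<delta> i j - (\<Sum>l\<in>B. \<bar>flow z \<delta> B i j l\<bar>)) / real (card B) > 0"
    using assms(2) by simp
  have "x + q - y > 0" if "q > 0" "y \<le> x" for q x y :: real using that by simp
  from this[OF * abs_ge_self] show ?thesis by (simp add: multiplier_def)
qed

section \<open>The dual certificate\<close>

text \<open>The weighted slacks of both clusters together reproduce the objective up to a constant. The reason is
that the squared distances minus the coefficients produced by the slacks have the separable form
\<open>\<phi> i + \<phi> j\<close>, on which the row-sum constraints act as constants; the diagonal entries are controlled by
the trace.\<close>

lemma objective_eq_const_plus_slacks: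
  fixes X d :: "'i \<Rightarrow> 'i \<Rightarrow> real" and z :: "'i \<Rightarrow> 'v::real_inner"
  assumes fin: "finite A" "finite B" "card A = N" "card B = N" "N > 0" and disj: "A \<inter> B = {}"
    and zA: "(\<Sum>i\<in>A. z i) = 0" and zB: "(\<Sum>k\<in>B. z k) = 0"
    and X: "\<And>i j. i \<in> A \<union> B \<Longrightarrow> j \<in> A \<union> B \<Longrightarrow> X i j = X j i"
    and row: "\<And>i. i \<in> A \<union> B \<Longrightarrow> (\<Sum>j\<in>A \<union> B. X i j) = 1"
    and trace: "(\<Sum>i\<in>A \<union> B. X i i) = 2"
    and d_in: "\<And>i j. i \<in> A \<and> j \<in> A \<or> i \<in> B \<and> j \<in> B \<Longrightarrow> d i j = (norm (z i - z j))\<^sup>2"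
    and d_out: "\<And>i k. i \<in> A \<Longrightarrow> k \<in> B \<Longrightarrow> d i k = (norm (z i - z k + \<delta>))\<^sup>2"
    and d_sym: "\<And>i k. i \<in> A \<Longrightarrow> k \<in> B \<Longrightarrow> d k i = d i k"
  shows "(\<Sum>i\<in>A \<union> B. \<Sum>j\<in>A \<union> B. d i j * X i j) =
    2 * (\<Sum>i\<in>A \<union> B. (norm (z i))\<^sup>2)
    + (\<Sum>i\<in>A. \<Sum>j\<in>A. \<Sum>k\<in>B. multiplier z \<delta> B i j k * triangle_slack X i j k)
    + (\<Sum>k\<in>B. \<Sum>l\<in>B. \<Sum>i\<in>A. multiplier z (-\<delta>) A k l i * triangle_slack X k l i)"
proof -
  define \<phi> where "\<phi> i = (norm (z i))\<^sup>2 + (if i \<in> A then z i \<bullet> \<delta> else - (z i \<bullet> \<delta>)) + \<delta> \<bullet> \<delta> / 2" for i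
  \<comment> \<open>The coefficient on the symmetric pair of entries \<open>X i k = X k i\<close> comes from the outflow of row
      \<open>i\<close> in its own cluster and from that of row \<open>k\<close> in the other one.\<close>
  define e where "e i k = z i \<bullet> (\<delta> - z k) + z k \<bullet> (- \<delta> - z i)" for i k
  have B: "i \<notin> A" if "i \<in> B" for i using that disj by blast
  have split: "(\<Sum>i\<in>A \<union> B. \<Sum>j\<in>A \<union> B. F i j) = (\<Sum>i\<in>A. \<Sum>j\<in>A. F i j) + (\<Sum>i\<in>A. \<Sum>k\<in>B. F i k)
      + (\<Sum>k\<in>B. \<Sum>i\<in>A. F k i) + (\<Sum>k\<in>B. \<Sum>l\<in>B. F k l)" for F :: "'i \<Rightarrow> 'i \<Rightarrow> real"
    using fin disj by (simp add: sum.union_disjoint sum.distrib)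
  have AA: "d i j * X i j = (\<phi> i + \<phi> j) * X i j - gap z \<delta> i j / 2 * X i j" if "i \<in> A" "j \<in> A" for i j
    unfolding left_diff_distrib[symmetric] using that
    by (simp add: d_in \<phi>_def half_gap power2_norm_eq_inner inner_diff_left inner_diff_right
        inner_add_left inner_add_right inner_commute)
  have BB: "d i j * X i j = (\<phi> i + \<phi> j) * X i j - gap z (-\<delta>) i j / 2 * X i j" if "i \<in> B" "j \<in> B" for i j
    unfolding left_diff_distrib[symmetric] using that B
    by (simp add: d_in \<phi>_def half_gap power2_norm_eq_inner inner_diff_left inner_diff_right
        inner_add_left inner_add_right inner_commute)
  have out: "d i k = \<phi> i + \<phi> k + e i k" if "i \<in> A" "k \<in> B" for i k
    using that B
    by (simp add: d_out \<phi>_def e_def power2_norm_eq_inner inner_diff_left inner_diff_right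
        inner_add_left inner_add_right inner_commute)
  have AB: "d i k * X i k = (\<phi> i + \<phi> k) * X i k + e i k * X i k" if "i \<in> A" "k \<in> B" for i k
    using out[OF that] by (simp add: algebra_simps)
  have BA: "d k i * X k i = (\<phi> k + \<phi> i) * X k i + e i k * X k i" if "i \<in> A" "k \<in> B" for i k
    using out[OF that] d_sym[OF that] by (simp add: algebra_simps)
  have swap: "(\<Sum>k\<in>B. \<Sum>i\<in>A. w i k * X k i) = (\<Sum>i\<in>A. \<Sum>k\<in>B. w i k * X i k)" for w :: "'i \<Rightarrow> 'i \<Rightarrow> real"
    using X by (subst sum.swap) (auto intro!: sum.cong)
  have "(\<Sum>i\<in>A \<union> B. \<Sum>j\<in>A \<union> B. d i j * X i j) = (\<Sum>i\<in>A \<union> B. \<Sum>j\<in>A \<union> B. (\<phi> i + \<phi> j) * X i j)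
     - (\<Sum>i\<in>A. \<Sum>j\<in>A. gap z \<delta> i j / 2 * X i j) - (\<Sum>k\<in>B. \<Sum>l\<in>B. gap z (-\<delta>) k l / 2 * X k l)
     + (\<Sum>i\<in>A. \<Sum>k\<in>B. e i k * X i k) + (\<Sum>k\<in>B. \<Sum>i\<in>A. e i k * X k i)"
    unfolding split by (simp add: AA BB AB BA sum.distrib sum_subtractf)
  also have "(\<Sum>i\<in>A \<union> B. \<Sum>j\<in>A \<union> B. (\<phi> i + \<phi> j) * X i j) = 2 * (\<Sum>i\<in>A \<union> B. \<phi> i)"
  proof -
    have 1: "(\<Sum>i\<in>A \<union> B. \<Sum>j\<in>A \<union> B. \<phi> i * X i j) = (\<Sum>i\<in>A \<union> B. \<phi> i)"
      by (simp add: sum_distrib_left[symmetric] row)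
    have "(\<Sum>i\<in>A \<union> B. \<Sum>j\<in>A \<union> B. \<phi> j * X i j) = (\<Sum>i\<in>A \<union> B. \<Sum>j\<in>A \<union> B. \<phi> i * X i j)"
      using X by (subst sum.swap) (auto intro!: sum.cong)
    then show ?thesis using 1 by (simp add: distrib_right sum.distrib)
  qed
  also have "(\<Sum>i\<in>A \<union> B. \<phi> i) = (\<Sum>i\<in>A \<union> B. (norm (z i))\<^sup>2) + N * (\<delta> \<bullet> \<delta>)"
  proof -
    have "(\<Sum>i\<in>A \<union> B. \<phi> i) = (\<Sum>i\<in>A. (norm (z i))\<^sup>2 + z i \<bullet> \<delta> + \<delta> \<bullet> \<delta> / 2)
        + (\<Sum>k\<in>B. (norm (z k))\<^sup>2 - z k \<bullet> \<delta> + \<delta> \<bullet> \<delta> / 2)"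
      using fin disj B by (simp add: sum.union_disjoint \<phi>_def)
    also have "\<dots> = (\<Sum>i\<in>A \<union> B. (norm (z i))\<^sup>2) + (\<Sum>i\<in>A. z i) \<bullet> \<delta> - (\<Sum>k\<in>B. z k) \<bullet> \<delta> + N * (\<delta> \<bullet> \<delta>)"
      using fin disj by (simp add: sum.union_disjoint sum.distrib sum_subtractf inner_sum_left)
    finally show ?thesis using zA zB by simp
  qed
  finally have obj: "(\<Sum>i\<in>A \<union> B. \<Sum>j\<in>A \<union> B. d i j * X i j) =
      2 * ((\<Sum>i\<in>A \<union> B. (norm (z i))\<^sup>2) + N * (\<delta> \<bullet> \<delta>))
      - (\<Sum>i\<in>A. \<Sum>j\<in>A. gap z \<delta> i j / 2 * X i j) - (\<Sum>k\<in>B. \<Sum>l\<in>B. gap z (-\<delta>) k l / 2 * X k l)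
      + (\<Sum>i\<in>A. \<Sum>k\<in>B. e i k * X i k) + (\<Sum>k\<in>B. \<Sum>i\<in>A. e i k * X k i)" .
  have cross: "(\<Sum>i\<in>A. \<Sum>k\<in>B. e i k * X i k) + (\<Sum>k\<in>B. \<Sum>i\<in>A. e i k * X k i) =
      (\<Sum>i\<in>A. \<Sum>k\<in>B. 2 * (z i \<bullet> (\<delta> - z k)) * X i k) + (\<Sum>k\<in>B. \<Sum>i\<in>A. 2 * (z k \<bullet> (- \<delta> - z i)) * X k i)"
    unfolding swap[of e] swap[of "\<lambda>i k. 2 * (z k \<bullet> (- \<delta> - z i))"]
    by (simp add: sum.distrib[symmetric] e_def algebra_simps)
  have SA: "(\<Sum>i\<in>A. \<Sum>j\<in>A. \<Sum>k\<in>B. multiplier z \<delta> B i j k * triangle_slack X i j k) =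
    real N * (\<delta> \<bullet> \<delta>) * (\<Sum>i\<in>A. X i i) - (\<Sum>i\<in>A. \<Sum>j\<in>A. gap z \<delta> i j / 2 * X i j)
    + (\<Sum>i\<in>A. \<Sum>k\<in>B. 2 * (z i \<bullet> (\<delta> - z k)) * X i k)"
    by (rule sum_multiplier_times_slack) (use assms in auto)
  have SB: "(\<Sum>k\<in>B. \<Sum>l\<in>B. \<Sum>i\<in>A. multiplier z (-\<delta>) A k l i * triangle_slack X k l i) =
    real N * (-\<delta> \<bullet> -\<delta>) * (\<Sum>k\<in>B. X k k) - (\<Sum>k\<in>B. \<Sum>l\<in>B. gap z (-\<delta>) k l / 2 * X k l)
    + (\<Sum>k\<in>B. \<Sum>i\<in>A. 2 * (z k \<bullet> (-\<delta> - z i)) * X k i)"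
    by (rule sum_multiplier_times_slack) (use assms in auto)
  have tr: "(\<Sum>i\<in>A. X i i) = 2 - (\<Sum>k\<in>B. X k k)"
    using trace fin disj by (simp add: sum.union_disjoint)
  have "real N * (\<delta> \<bullet> \<delta>) * (\<Sum>i\<in>A. X i i) + real N * (-\<delta> \<bullet> -\<delta>) * (\<Sum>k\<in>B. X k k)
      = 2 * (real N * (\<delta> \<bullet> \<delta>))"
    unfolding tr by (simp add: algebra_simps)
  then show ?thesis using obj cross unfolding SA SB by (simp only: distrib_left)
qed

text \<open>Adding the tight slacks of \<open>(i; j, k)\<close> and \<open>(j; i, k)\<close> gives \<open>2 * X i j = X i i + X j j\<close>
inside a cluster; subtracting them shows that \<open>X i k\<close> varies with \<open>i\<close> only through \<open>X i i / 2\<close>. Hence \<open>X\<close> has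
the form \<open>h i + h j\<close>, plus a constant \<open>\<tau>\<close> across the clusters, and the row sums together with the
trace determine \<open>h\<close> and \<open>\<tau>\<close>.\<close>

lemma tight_slacks_imp_planted:
  fixes X :: "'i \<Rightarrow> 'i \<Rightarrow> real"
  assumes fin: "finite A" "finite B" "card A = N" "card B = N" "N > 0" and disj: "A \<inter> B = {}"
    and X: "\<And>i j. i \<in> A \<union> B \<Longrightarrow> j \<in> A \<union> B \<Longrightarrow> X i j = X j i"
    and row: "\<And>i. i \<in> A \<union> B \<Longrightarrow> (\<Sum>j\<in>A \<union> B. X i j) = 1"
    and trace: "(\<Sum>i\<in>A \<union> B. X i i) = 2"
    and tA: "\<And>i j k. i \<in> A \<Longrightarrow> j \<in> A \<Longrightarrow> k \<in> B \<Longrightarrow> triangle_slack X i j k = 0"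
    and tB: "\<And>i j k. i \<in> B \<Longrightarrow> j \<in> B \<Longrightarrow> k \<in> A \<Longrightarrow> triangle_slack X i j k = 0"
    and ij: "i \<in> A \<union> B" "j \<in> A \<union> B"
  shows "X i j = (if i \<in> A \<longleftrightarrow> j \<in> A then 1 / real N else 0)"
proof -
  define h where "h i = X i i / 2" for i
  obtain a b where ab: "a \<in> A" "b \<in> B"
    using fin by (metis card.empty equals0I less_numeral_extra(3))
  define \<tau> where "\<tau> = X a b - h a - h b"
  have inA: "X i j = h i + h j" if "i \<in> A" "j \<in> A" for i j
    using tA[OF that ab(2)] tA[OF that(2,1) ab(2)] X[of i j] that
    by (simp add: triangle_slack_def h_def)
  have inB: "X i j = h i + h j" if "i \<in> B" "j \<in> B" for i j
    using tB[OF that ab(1)] tB[OF that(2,1) ab(1)] X[of i j] that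
    by (simp add: triangle_slack_def h_def)
  have out: "X i k = h i + h k + \<tau>" if "i \<in> A" "k \<in> B" for i k
    using tA[OF that(1) ab(1) that(2)] tB[OF that(2) ab(2) ab(1)] inA[OF that(1) ab(1)]
      inB[OF that(2) ab(2)] X[of k a] X[of b a] that ab
    by (simp add: triangle_slack_def h_def \<tau>_def)
  have H: "(\<Sum>i\<in>A. h i) + (\<Sum>k\<in>B. h k) = 1"
    using trace fin disj by (simp add: h_def sum.union_disjoint sum_divide_distrib[symmetric])
  have h: "h i = - \<tau> / 2" if "i \<in> A \<union> B" for i
  proof (cases "i \<in> A")
    case True
    have "1 = (\<Sum>j\<in>A. h i + h j) + (\<Sum>k\<in>B. h i + h k + \<tau>)"
      using row[OF that] fin disj True by (simp add: sum.union_disjoint inA out)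
    also have "\<dots> = 2 * N * h i + N * \<tau> + 1"
      using fin H by (simp add: sum.distrib)
    finally have "N * (2 * h i + \<tau>) = 0" by (simp add: algebra_simps)
    then show ?thesis using fin(5) by simp
  next
    case False
    then have i: "i \<in> B" using that by simp
    have "X i j = h j + h i + \<tau>" if "j \<in> A" for j
      using out[OF that i] X[of i j] that i by simp
    then have "1 = (\<Sum>j\<in>A. h j + h i + \<tau>) + (\<Sum>k\<in>B. h i + h k)"
      using row[OF that] fin disj i by (simp add: sum.union_disjoint inB)
    also have "\<dots> = 2 * N * h i + N * \<tau> + 1"
      using fin H by (simp add: sum.distrib)
    finally have "N * (2 * h i + \<tau>) = 0" by (simp add: algebra_simps)
    then show ?thesis using fin(5) by simp
  qed
  have "\<tau> = - 1 / N"
    using H fin by (simp add: h field_simps)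
  then show ?thesis
    using ij inA[of i j] inB[of i j] out[of i j] out[of j i] X[of i j] h[of i] h[of j] disj by auto
qed

lemma planted_matrix_eq:
  assumes "i \<in> {1..2 * N}" "j \<in> {1..2 * N}"
  shows "planted_matrix (2 * N) i j = (if i \<le> N \<longleftrightarrow> j \<le> N then 1 / real N else 0)"
  using assms by (auto simp: planted_matrix_def planted_cluster_def)

lemma lp2_feasible_planted:
  assumes "N > 0"
  shows "lp2_feasible (2 * N) (planted_matrix (2 * N))"
proof -
  have "(\<Sum>j=1..2 * N. planted_matrix (2 * N) i j) = 1" if i: "i \<in> {1..2 * N}" for i
  proof -
    have "(\<Sum>j=1..2 * N. planted_matrix (2 * N) i j)
        = (\<Sum>j=1..2 * N. if i \<le> N \<longleftrightarrow> j \<le> N then 1 / real N else 0)"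
      using i by (intro sum.cong refl planted_matrix_eq)
    also have "\<dots> = card {j \<in> {1..2 * N}. i \<le> N \<longleftrightarrow> j \<le> N} / real N"
      by (simp add: sum.If_cases Int_def)
    also have "{j \<in> {1..2 * N}. i \<le> N \<longleftrightarrow> j \<le> N} = (if i \<le> N then {1..N} else {N + 1..2 * N})"
      by auto
    finally show ?thesis using assms by (auto split: if_splits)
  qed
  moreover have "(\<Sum>i=1..2 * N. planted_matrix (2 * N) i i) = 2"
  proof -
    have "(\<Sum>i=1..2 * N. planted_matrix (2 * N) i i) = (\<Sum>i=1..2 * N. 1 / real N)"
      by (intro sum.cong refl) (subst planted_matrix_eq, auto)
    then show ?thesis using assms by simp
  qed
  ultimately show ?thesis
    using assms unfolding lp2_feasible_def by (auto simp: planted_matrix_eq)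
qed

lemma triangle_slack_nonneg:
  assumes "lp2_feasible n X" "i \<in> {1..n}" "j \<in> {1..n}" "k \<in> {1..n}" "k \<noteq> i" "k \<noteq> j"
  shows "triangle_slack X i j k \<ge> 0"
proof (cases "i = j")
  case False
  then show ?thesis
    using assms unfolding lp2_feasible_def triangle_slack_def by (smt (verit))
qed (simp add: triangle_slack_def)

text \<open>The multipliers form a dual certificate: the objective exceeds its value at the planted matrix by a
combination of slacks with positive weights. At the planted matrix all these slacks vanish, and
nowhere else.\<close>

lemma lp2_recovers_if_separated:
  fixes x :: "nat \<Rightarrow> real ^ 'm"
  assumes N: "N > 0"
    and g1: "(\<Sum>i=1..N. x i - g1) = 0" and g2: "(\<Sum>i=N + 1..2 * N. x i - g2) = 0"
    and R1: "\<And>i. i \<in> {1..N} \<Longrightarrow> norm (x i - g1) \<le> R"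
    and R2: "\<And>i. i \<in> {N + 1..2 * N} \<Longrightarrow> norm (x i - g2) \<le> R"
    and sep: "norm (g1 - g2) > (1 + sqrt 3) * R"
  shows "lp2_recovers (2 * N) (sq_dist x)"
proof -
  define A where "A = {1..N}"
  define B where "B = {N + 1..2 * N}"
  define U where "U = {1..2 * N}"
  define z where "z i = (if i \<le> N then x i - g1 else x i - g2)" for i
  define \<delta> where "\<delta> = g1 - g2"
  have U: "U = A \<union> B" by (auto simp: U_def A_def B_def)
  have AB: "finite A" "finite B" "card A = N" "card B = N" "A \<inter> B = {}"
    by (auto simp: A_def B_def)
  have z1: "z i = x i - g1" if "i \<in> A" for i using that by (simp add: z_def A_def)
  have z2: "z i = x i - g2" if "i \<in> B" for i using that by (simp add: z_def B_def)
  have zA: "(\<Sum>i\<in>A. z i) = 0" using g1 unfolding A_def[symmetric] by (simp add: z1)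
  have zB: "(\<Sum>i\<in>B. z i) = 0" using g2 unfolding B_def[symmetric] by (simp add: z2)
  have RA: "norm (z i) \<le> R" if "i \<in> A" for i using R1 that unfolding A_def[symmetric] by (simp add: z1)
  have RB: "norm (z i) \<le> R" if "i \<in> B" for i using R2 that unfolding B_def[symmetric] by (simp add: z2)
  define P where "P = planted_matrix (2 * N)"
  define SA where "SA X = (\<Sum>i\<in>A. \<Sum>j\<in>A. \<Sum>k\<in>B. multiplier z \<delta> B i j k * triangle_slack X i j k)" for X
  define SB where "SB X = (\<Sum>i\<in>B. \<Sum>j\<in>B. \<Sum>k\<in>A. multiplier z (-\<delta>) A i j k * triangle_slack X i j k)" for X
  define K where "K = 2 * (\<Sum>i\<in>A \<union> B. (norm (z i))\<^sup>2)"
  have feasibleD: "\<And>i j. i \<in> A \<union> B \<Longrightarrow> j \<in> A \<union> B \<Longrightarrow> X i j = X j i"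
      "\<And>i. i \<in> A \<union> B \<Longrightarrow> (\<Sum>j\<in>A \<union> B. X i j) = 1" "(\<Sum>i\<in>A \<union> B. X i i) = 2"
    if "lp2_feasible (2 * N) X" for X
    using that unfolding lp2_feasible_def U_def[symmetric] U by blast+
  have objective: "lp2_objective (2 * N) (sq_dist x) X = K + SA X + SB X"
    if "lp2_feasible (2 * N) X" for X
    unfolding lp2_objective_def U_def[symmetric] U K_def SA_def SB_def
  proof (rule objective_eq_const_plus_slacks[OF AB(1-4) N AB(5) zA zB feasibleD[OF that]])
    show "sq_dist x i j = (norm (z i - z j))\<^sup>2" if "i \<in> A \<and> j \<in> A \<or> i \<in> B \<and> j \<in> B" for i j
      using that by (auto simp: sq_dist_def z1 z2)
    show "sq_dist x i k = (norm (z i - z k + \<delta>))\<^sup>2" if "i \<in> A" "k \<in> B" for i k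
      using that by (simp add: sq_dist_def z1 z2 \<delta>_def algebra_simps)
    show "sq_dist x k i = sq_dist x i k" for i k
      by (simp add: sq_dist_def norm_minus_commute)
  qed
  have posA: "multiplier z \<delta> B i j k > 0" if "i \<in> A" "j \<in> A" for i j k
    by (rule multiplier_pos[where R = R]) (use AB N zB RA RB that sep in \<open>auto simp: \<delta>_def\<close>)
  have posB: "multiplier z (-\<delta>) A i j k > 0" if "i \<in> B" "j \<in> B" for i j k
    by (rule multiplier_pos[where R = R]) (use AB N zA RA RB that sep in \<open>auto simp: \<delta>_def norm_minus_commute\<close>)
  have termA: "multiplier z \<delta> B i j k * triangle_slack X i j k \<ge> 0"
    if "lp2_feasible (2 * N) X" "i \<in> A" "j \<in> A" "k \<in> B" for X i j k
    using posA[OF that(2,3), of k] that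
    by (intro mult_nonneg_nonneg triangle_slack_nonneg[OF that(1)]) (auto simp: A_def B_def)
  have termB: "multiplier z (-\<delta>) A i j k * triangle_slack X i j k \<ge> 0"
    if "lp2_feasible (2 * N) X" "i \<in> B" "j \<in> B" "k \<in> A" for X i j k
    using posB[OF that(2,3), of k] that
    by (intro mult_nonneg_nonneg triangle_slack_nonneg[OF that(1)]) (auto simp: A_def B_def)
  have SA0: "SA X \<ge> 0" and SB0: "SB X \<ge> 0" if "lp2_feasible (2 * N) X" for X
    unfolding SA_def SB_def by (intro sum_nonneg termA[OF that] termB[OF that]; assumption)+
  have P: "lp2_feasible (2 * N) P" unfolding P_def by (rule lp2_feasible_planted[OF N])
  have Peq: "P i j = (if i \<in> A \<longleftrightarrow> j \<in> A then 1 / real N else 0)" if "i \<in> A \<union> B" "j \<in> A \<union> B" for i j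
    unfolding P_def by (subst planted_matrix_eq) (use that in \<open>auto simp: A_def B_def\<close>)
  have notA: "i \<notin> A" if "i \<in> B" for i using that AB by blast
  have "SA P = 0" unfolding SA_def by (intro sum.neutral ballI) (simp add: triangle_slack_def Peq notA)
  moreover have "SB P = 0" unfolding SB_def by (intro sum.neutral ballI) (simp add: triangle_slack_def Peq notA)
  ultimately have objP: "lp2_objective (2 * N) (sq_dist x) P = K" using objective[OF P] by simp
  then have optP: "lp2_optimal (2 * N) (sq_dist x) P"
    unfolding lp2_optimal_def using P objective SA0 SB0 by (smt (verit))
  have "X i j = P i j" if opt: "lp2_optimal (2 * N) (sq_dist x) X" and ij: "i \<in> A \<union> B" "j \<in> A \<union> B" for X i j
  proof -
    have X: "lp2_feasible (2 * N) X" using opt by (simp add: lp2_optimal_def)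
    have "lp2_objective (2 * N) (sq_dist x) X \<le> K" using opt P objP by (auto simp: lp2_optimal_def)
    then have "SA X = 0" "SB X = 0" using objective[OF X] SA0[OF X] SB0[OF X] by linarith+
    have "triangle_slack X i j k = 0" if "i \<in> A" "j \<in> A" "k \<in> B" for i j k
    proof -
      have "multiplier z \<delta> B i j k * triangle_slack X i j k = 0"
        using \<open>SA X = 0\<close> that termA[OF X] AB unfolding SA_def
        by (simp add: sum_nonneg_eq_0_iff sum_nonneg)
      then show ?thesis using posA[OF that(1,2), of k] by simp
    qed
    moreover have "triangle_slack X i j k = 0" if "i \<in> B" "j \<in> B" "k \<in> A" for i j k
    proof -
      have "multiplier z (-\<delta>) A i j k * triangle_slack X i j k = 0"
        using \<open>SB X = 0\<close> that termB[OF X] AB unfolding SB_def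
        by (simp add: sum_nonneg_eq_0_iff sum_nonneg)
      then show ?thesis using posB[OF that(1,2), of k] by simp
    qed
    ultimately have "X i j = (if i \<in> A \<longleftrightarrow> j \<in> A then 1 / real N else 0)"
      by (intro tight_slacks_imp_planted[OF AB(1-4) N AB(5) feasibleD[OF X] _ _ ij])
    then show ?thesis using Peq[OF ij] by simp
  qed
  then show ?thesis using optP unfolding lp2_recovers_def P_def U_def[symmetric] U by blast
qed

section \<open>Measurability of the recovery event\<close>

lemma open_Collect_ball_compact:
  assumes "compact K" "open W"
  shows "open {x. \<forall>y\<in>K. (x, y) \<in> W}"
proof (subst open_subopen, intro ballI)
  fix x assume "x \<in> {x. \<forall>y\<in>K. (x, y) \<in> W}"
  then have "{x} \<times> K \<subseteq> W" by auto
  from Elementary_Topology.tube_lemma[OF assms this] obtain T where "x \<in> T" "open T" "T \<times> K \<subseteq> W" by blast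
  then show "\<exists>T. open T \<and> x \<in> T \<and> T \<subseteq> {x. \<forall>y\<in>K. (x, y) \<in> W}" by blast
qed

lemma lp2_feasible_segment:
  assumes X: "lp2_feasible n X" and Y: "lp2_feasible n Y" and t: "0 \<le> t" "t \<le> 1"
    and W: "\<And>i j. i \<in> {1..n} \<Longrightarrow> j \<in> {1..n} \<Longrightarrow> W i j = X i j + t * (Y i j - X i j)"
  shows "lp2_feasible n W"
proof -
  have mix: "u + t * (v - u) \<le> u' + t * (v' - u')" if "u \<le> u'" "v \<le> v'" for u v u' v' :: real
  proof -
    have "(1 - t) * u + t * v \<le> (1 - t) * u' + t * v'"
      using t that by (intro add_mono mult_left_mono) auto
    then show ?thesis by (simp add: algebra_simps)
  qed
  have "W i j = W j i" if "i \<in> {1..n}" "j \<in> {1..n}" for i j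
    using X Y W that unfolding lp2_feasible_def by auto
  moreover have "(\<Sum>i=1..n. W i i) = 2"
  proof -
    have "(\<Sum>i=1..n. W i i) = (\<Sum>i=1..n. X i i) + t * ((\<Sum>i=1..n. Y i i) - (\<Sum>i=1..n. X i i))"
      unfolding sum_subtractf[symmetric] sum_distrib_left sum.distrib[symmetric]
      by (intro sum.cong refl W)
    then show ?thesis using X Y unfolding lp2_feasible_def by simp
  qed
  moreover have "(\<Sum>j=1..n. W i j) = 1" if "i \<in> {1..n}" for i
  proof -
    have "(\<Sum>j=1..n. W i j) = (\<Sum>j=1..n. X i j) + t * ((\<Sum>j=1..n. Y i j) - (\<Sum>j=1..n. X i j))"
      unfolding sum_subtractf[symmetric] sum_distrib_left sum.distrib[symmetric]
      by (intro sum.cong refl W that)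
    moreover have "(\<Sum>j=1..n. X i j) = 1" "(\<Sum>j=1..n. Y i j) = 1"
      using X Y that unfolding lp2_feasible_def by blast+
    ultimately show ?thesis by simp
  qed
  moreover have "W i j + W i k \<le> W i i + W j k"
    if i: "i \<in> {1..n}" and j: "j \<in> {1..n}" and k: "k \<in> {1..n}" and ne: "i \<noteq> j" "i \<noteq> k" "j \<noteq> k" for i j k
  proof -
    have "X i j + X i k \<le> X i i + X j k" "Y i j + Y i k \<le> Y i i + Y j k"
      using X Y i j k ne unfolding lp2_feasible_def by blast+
    from mix[OF this] show ?thesis using W[OF i j] W[OF i k] W[OF i i] W[OF j k]
      by (simp add: algebra_simps)
  qed
  ultimately show ?thesis unfolding lp2_feasible_def by blast
qed

text \<open>Directions from the planted matrix to the feasible points at entrywise 1-norm distance \<open>r\<close>. Entries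
outside the matrix are set to zero, so that this is a compact set of functions in the product topology.\<close>

definition feasible_sphere :: "nat \<Rightarrow> real \<Rightarrow> (nat \<times> nat \<Rightarrow> real) set" where
  "feasible_sphere n r = {Z. (\<forall>p\<in>- ({1..n} \<times> {1..n}). Z p = 0) \<and>
     (\<Sum>p\<in>{1..n} \<times> {1..n}. \<bar>Z p\<bar>) = r \<and>
     lp2_feasible n (\<lambda>i j. planted_matrix n i j + Z (i, j))}"

lemma closed_Collect_bounded_all:
  assumes "\<And>i. i \<in> S \<Longrightarrow> closed {x. Q i x}"
  shows "closed {x. \<forall>i\<in>S. Q i x}"
  using assms by (auto simp: Collect_ball_eq intro: closed_INT)

lemma compact_feasible_sphere: "compact (feasible_sphere n r)"
proof -
  let ?I = "{1..n} \<times> {1..n}"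
  have "compactin (product_topology (\<lambda>_. euclidean) UNIV) (PiE UNIV (\<lambda>p::nat \<times> nat. {-\<bar>r\<bar>..\<bar>r\<bar>}))"
    by (subst compactin_PiE) auto
  then have box: "compact (PiE UNIV (\<lambda>p::nat \<times> nat. {-\<bar>r\<bar>..\<bar>r\<bar>}))"
    by (simp add: euclidean_product_topology)
  have coord: "continuous_on UNIV (\<lambda>Z :: nat \<times> nat \<Rightarrow> real. Z p)" for p
    by simp
  have cl: "closed {x. c \<longrightarrow> Q x}" if "c \<Longrightarrow> closed {x. Q x}" for c and Q :: "(nat \<times> nat \<Rightarrow> real) \<Rightarrow> bool"
    using that by (cases c) auto
  have "closed (feasible_sphere n r)"
    unfolding feasible_sphere_def lp2_feasible_def
    by (intro closed_Collect_conj closed_Collect_bounded_all cl closed_Collect_eq closed_Collect_le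
        continuous_intros coord)
  moreover have "feasible_sphere n r \<subseteq> PiE UNIV (\<lambda>p. {-\<bar>r\<bar>..\<bar>r\<bar>})"
  proof
    fix Z assume Z: "Z \<in> feasible_sphere n r"
    have "\<bar>Z p\<bar> \<le> \<bar>r\<bar>" for p
    proof (cases "p \<in> ?I")
      case True
      have "\<bar>Z p\<bar> \<le> (\<Sum>p\<in>?I. \<bar>Z p\<bar>)" by (rule member_le_sum[OF True]) auto
      then show ?thesis using Z by (auto simp: feasible_sphere_def)
    next
      case False
      then have "Z p = 0" using Z unfolding feasible_sphere_def by blast
      then show ?thesis by simp
    qed
    then show "Z \<in> PiE UNIV (\<lambda>p. {-\<bar>r\<bar>..\<bar>r\<bar>})" by (auto simp: PiE_iff abs_le_iff) (smt (verit))
  qed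
  ultimately show ?thesis using closed_Int_compact[OF _ box] by (metis inf.absorb1)
qed

text \<open>The strict inequality that expresses unique optimality degenerates for competitors close to the planted
matrix, so a single compact set of competitors would not do. By convexity every competitor can be moved towards the planted matrix until it lies on a
sphere of radius \<open>1 / Suc m\<close>, so countably many compact sets of competitors suffice.\<close>

lemma lp2_recovers_iff_sphere:
  assumes P: "lp2_feasible n (planted_matrix n)"
  shows "lp2_recovers n d \<longleftrightarrow>
    (\<forall>m::nat. \<forall>Z\<in>feasible_sphere n (1 / Suc m). 0 < (\<Sum>(i, j)\<in>{1..n} \<times> {1..n}. d i j * Z (i, j)))"
proof -
  define I where "I = {1..n} \<times> {1..n}"
  let ?P = "planted_matrix n"
  have obj: "lp2_objective n d X = (\<Sum>(i, j)\<in>I. d i j * X i j)" for X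
    by (simp add: lp2_objective_def I_def sum.cartesian_product)
  show ?thesis unfolding I_def[symmetric]
  proof (intro iffI allI ballI)
    fix m :: nat and Z
    assume rec: "lp2_recovers n d" and Z: "Z \<in> feasible_sphere n (1 / Suc m)"
    define Y where "Y i j = ?P i j + Z (i, j)" for i j
    have Y: "lp2_feasible n Y" and Z1: "(\<Sum>p\<in>I. \<bar>Z p\<bar>) > 0"
      using Z by (auto simp: feasible_sphere_def Y_def[abs_def] I_def)
    have objY: "lp2_objective n d Y = lp2_objective n d ?P + (\<Sum>(i, j)\<in>I. d i j * Z (i, j))"
      by (simp add: obj Y_def distrib_left sum.distrib split_beta)
    obtain p where "p \<in> I" "Z p \<noteq> 0" using Z1 by (metis abs_zero less_irrefl sum.neutral)
    then have "\<not> (\<forall>i\<in>{1..n}. \<forall>j\<in>{1..n}. Y i j = ?P i j)"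
      by (auto simp: Y_def I_def)
    then have "\<not> lp2_optimal n d Y" using rec unfolding lp2_recovers_def by blast
    then show "0 < (\<Sum>(i, j)\<in>I. d i j * Z (i, j))"
      using rec Y objY unfolding lp2_recovers_def lp2_optimal_def by (smt (verit))
  next
    assume pos: "\<forall>m::nat. \<forall>Z\<in>feasible_sphere n (1 / Suc m). 0 < (\<Sum>(i, j)\<in>I. d i j * Z (i, j))"
    have less: "lp2_objective n d ?P < lp2_objective n d Y"
      if Y: "lp2_feasible n Y" and ne: "\<not> (\<forall>i\<in>{1..n}. \<forall>j\<in>{1..n}. Y i j = ?P i j)" for Y
    proof -
      define s where "s = (\<Sum>(i, j)\<in>I. \<bar>Y i j - ?P i j\<bar>)"
      obtain i j where ij: "(i, j) \<in> I" "Y i j \<noteq> ?P i j" using ne by (auto simp: I_def)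
      have "\<bar>Y i j - ?P i j\<bar> \<le> s"
        using member_le_sum[OF ij(1), of "\<lambda>(i, j). \<bar>Y i j - ?P i j\<bar>"] by (auto simp: s_def I_def)
      then have s: "s > 0" using ij(2) by simp
      then obtain m where m: "1 / real (Suc m) < s"
        using reals_Archimedean by (auto simp: inverse_eq_divide)
      define t where "t = 1 / real (Suc m) / s"
      have t: "0 < t" "t \<le> 1" using m s unfolding t_def by (simp_all only: divide_le_eq_1_pos zero_less_divide_iff) auto
      define Z where "Z p = (if p \<in> I then t * (Y (fst p) (snd p) - ?P (fst p) (snd p)) else 0)" for p
      have "(\<Sum>p\<in>I. \<bar>Z p\<bar>) = t * s"
        using t by (simp add: Z_def s_def sum_distrib_left abs_mult split_beta)
      also have "\<dots> = 1 / Suc m" using s by (simp add: t_def)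
      finally have "(\<Sum>p\<in>I. \<bar>Z p\<bar>) = 1 / Suc m" .
      moreover have "lp2_feasible n (\<lambda>i j. ?P i j + Z (i, j))"
        using t by (intro lp2_feasible_segment[OF P Y, of t]) (auto simp: Z_def I_def)
      ultimately have "Z \<in> feasible_sphere n (1 / Suc m)"
        unfolding feasible_sphere_def I_def[symmetric] by (simp add: Z_def)
      then have "0 < (\<Sum>(i, j)\<in>I. d i j * Z (i, j))" using pos by blast
      also have "(\<Sum>(i, j)\<in>I. d i j * Z (i, j)) = t * (lp2_objective n d Y - lp2_objective n d ?P)"
        unfolding obj sum_subtractf[symmetric] sum_distrib_left
        by (intro sum.cong refl) (auto simp: Z_def algebra_simps)
      finally show ?thesis using t by (simp add: zero_less_mult_iff)
    qed
    have "lp2_objective n d ?P \<le> lp2_objective n d Y" if "lp2_feasible n Y" for Y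
    proof (cases "\<forall>i\<in>{1..n}. \<forall>j\<in>{1..n}. Y i j = ?P i j")
      case True
      then have "lp2_objective n d Y = lp2_objective n d ?P"
        unfolding lp2_objective_def by (intro sum.cong refl) auto
      then show ?thesis by simp
    qed (use less[OF that] in simp)
    then show "lp2_recovers n d"
      using P less unfolding lp2_recovers_def lp2_optimal_def by (meson not_less)
  qed
qed

text \<open>On a compact set of competitors the strict inequality is an open condition on the cost matrix (tube
lemma), so recovery is a countable intersection of open conditions on the costs.\<close>

lemma sets_lp2_recovers:
  fixes d :: "'a \<Rightarrow> nat \<Rightarrow> nat \<Rightarrow> real"
  assumes P: "lp2_feasible n (planted_matrix n)"
    and d: "\<And>i j. i \<in> {1..n} \<Longrightarrow> j \<in> {1..n} \<Longrightarrow> (\<lambda>\<omega>. d \<omega> i j) \<in> borel_measurable M"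
  shows "{\<omega> \<in> space M. lp2_recovers n (d \<omega>)} \<in> sets M"
proof -
  define I where "I = {1..n} \<times> {1..n}"
  define F where "F \<omega> p = (if p \<in> I then d \<omega> (fst p) (snd p) else 0)" for \<omega> p
  have "F \<in> borel_measurable M"
  proof (rule measurable_coordinatewise_then_product)
    show "(\<lambda>\<omega>. F \<omega> p) \<in> borel_measurable M" for p
      using d by (cases "p \<in> I") (auto simp: F_def I_def)
  qed
  define W :: "((nat \<times> nat \<Rightarrow> real) \<times> (nat \<times> nat \<Rightarrow> real)) set"
    where "W = {q. 0 < (\<Sum>p\<in>I. fst q p * snd q p)}"
  have coord: "continuous_on UNIV (\<lambda>Z :: nat \<times> nat \<Rightarrow> real. Z p)" for p
    by simp
  have "open W" unfolding W_def
    by (intro open_Collect_less continuous_intros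
        continuous_on_compose2[OF coord continuous_on_fst] continuous_on_compose2[OF coord continuous_on_snd]) auto
  define G where "G m = {x. \<forall>Z\<in>feasible_sphere n (1 / Suc m). (x, Z) \<in> W}" for m
  have "open (G m)" for m
    unfolding G_def by (rule open_Collect_ball_compact[OF compact_feasible_sphere \<open>open W\<close>])
  then have "(\<Inter>m. F -` G m \<inter> space M) \<in> sets M"
    using \<open>F \<in> borel_measurable M\<close> by (intro sets.countable_INT' measurable_sets) auto
  moreover have "lp2_recovers n (d \<omega>) \<longleftrightarrow> (\<forall>m. F \<omega> \<in> G m)" for \<omega>
  proof -
    have "(\<Sum>(i, j)\<in>I. d \<omega> i j * Z (i, j)) = (\<Sum>p\<in>I. F \<omega> p * Z p)" for Z
      by (intro sum.cong refl) (auto simp: F_def)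
    then show ?thesis
      unfolding lp2_recovers_iff_sphere[OF P] I_def[symmetric] G_def W_def by simp
  qed
  then have "{\<omega> \<in> space M. lp2_recovers n (d \<omega>)} = (\<Inter>m. F -` G m \<inter> space M)" by auto
  ultimately show ?thesis by simp
qed

section \<open>Concentration of the empirical means\<close>

text \<open>The reflection at the origin is an orthogonal map, so a rotation-invariant law is symmetric.\<close>

lemma ball_distribution_integral_coordinate:
  fixes D :: "(real ^ 'm) measure"
  assumes D: "ball_distribution D"
  shows "(\<integral>z. z $ c \<partial>D) = 0"
proof -
  have sets: "sets D = sets borel" using D by (simp add: ball_distribution_def)
  have "orthogonal_transformation (uminus :: real ^ 'm \<Rightarrow> real ^ 'm)"
    by (simp add: orthogonal_transformation_def linear_uminus)
  then have "distr D borel uminus = D"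
    using D by (auto simp: ball_distribution_def rotation_invariant_def)
  then have "(\<integral>z. z $ c \<partial>D) = (\<integral>z. z $ c \<partial>distr D borel uminus)" by simp
  also have "\<dots> = (\<integral>z. (- z) $ c \<partial>D)"
    by (rule integral_distr) (auto simp: measurable_cong_sets[OF sets refl])
  also have "\<dots> = - (\<integral>z. z $ c \<partial>D)" by simp
  finally show ?thesis by simp
qed

context
  fixes M :: "'a measure" and D :: "(real ^ 'm) measure" and N :: nat
    and y :: "nat \<Rightarrow> nat \<Rightarrow> 'a \<Rightarrow> real ^ 'm"
  assumes D: "ball_distribution D" and draws: "sbm_draws M D N y"
begin

lemma measurable_draw:
  assumes "k \<in> {1, 2}" "i \<in> {1..N}"
  shows "y k i \<in> borel_measurable M"
proof -
  interpret prob_space M using draws by (simp add: sbm_draws_def)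
  have "indep_vars (\<lambda>_. borel) (\<lambda>(k, i). y k i) ({1, 2} \<times> {1..N})"
    using draws by (simp add: sbm_draws_def)
  then have "\<forall>p\<in>{1, 2} \<times> {1..N}. random_variable borel (case p of (k, i) \<Rightarrow> y k i)"
    by (simp add: indep_vars_def)
  from bspec[OF this, of "(k, i)"] show ?thesis using assms by simp
qed

lemma AE_draw_bounded:
  assumes "k \<in> {1, 2}" "i \<in> {1..N}"
  shows "AE \<omega> in M. norm (y k i \<omega>) \<le> 1"
proof -
  have "distr M borel (y k i) = D"
    using draws assms unfolding sbm_draws_def by blast
  moreover have "AE z in D. norm z \<le> 1"
    using D by (simp add: ball_distribution_def)
  ultimately have "AE z in distr M borel (y k i). norm z \<le> 1" by (simp only:)
  then show ?thesis
    by (subst (asm) AE_distr_iff) (use measurable_draw[OF assms] in auto)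
qed

lemma integral_draw_coordinate:
  assumes "k \<in> {1, 2}" "i \<in> {1..N}"
  shows "(\<integral>\<omega>. y k i \<omega> $ c \<partial>M) = 0"
proof -
  have "distr M borel (y k i) = D"
    using draws assms unfolding sbm_draws_def by blast
  moreover have "(\<integral>\<omega>. y k i \<omega> $ c \<partial>M) = (\<integral>z. z $ c \<partial>distr M borel (y k i))"
    by (rule integral_distr[symmetric]) (use measurable_draw[OF assms] in auto)
  ultimately show ?thesis using ball_distribution_integral_coordinate[OF D] by simp
qed

text \<open>Hoeffding's inequality, each coordinate of a draw lying in \<open>{-1..1}\<close>.\<close>

lemma prob_coordinate_sum_ge:
  fixes \<epsilon> :: real
  assumes k: "k \<in> {1, 2}" and \<epsilon>: "\<epsilon> > 0" and N: "N > 0"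
  shows "measure M {\<omega> \<in> space M. \<bar>\<Sum>i=1..N. y k i \<omega> $ c\<bar> \<ge> N * \<epsilon>} \<le> 2 * exp (- (\<epsilon>\<^sup>2 / 2) * N)"
proof -
  interpret prob_space M using draws by (simp add: sbm_draws_def)
  define I where "I = {k} \<times> {1..N}"
  define X where "X p \<omega> = y (fst p) (snd p) \<omega> $ c" for p \<omega>
  have iv: "indep_vars (\<lambda>_. borel) (\<lambda>(k, i). y k i) ({1, 2} \<times> {1..N})"
    using draws by (simp add: sbm_draws_def)
  have "indep_vars (\<lambda>_. borel) (\<lambda>(k, i). y k i) I"
    by (rule indep_vars_subset[OF iv]) (use k in \<open>auto simp: I_def\<close>)
  then have "indep_vars (\<lambda>_. borel) (\<lambda>p \<omega>. (case p of (k, i) \<Rightarrow> y k i) \<omega> $ c) I"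
    by (rule indep_vars_compose2[where Y = "\<lambda>_ v. v $ c"]) auto
  then have indep: "indep_vars (\<lambda>_. borel) X I"
    by (simp add: X_def[abs_def] case_prod_beta)
  interpret Hoeffding_ineq M I X "\<lambda>_. -1" "\<lambda>_. 1" 0
  proof unfold_locales
    show "finite I" by (simp add: I_def)
    show "indep_vars (\<lambda>_. borel) X I" by (fact indep)
    show "AE \<omega> in M. X p \<omega> \<in> {-1..1}" if "p \<in> I" for p
    proof -
      have "AE \<omega> in M. norm (y (fst p) (snd p) \<omega>) \<le> 1"
        using that k by (intro AE_draw_bounded) (auto simp: I_def)
      then show ?thesis
      proof eventually_elim
        case (elim \<omega>)
        then have "\<bar>X p \<omega>\<bar> \<le> 1" unfolding X_def
          using component_le_norm_cart[of "y (fst p) (snd p) \<omega>" c] by linarith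
        then show ?case by auto
      qed
    qed
    show "0 \<equiv> \<Sum>p\<in>I. expectation (X p)"
    proof (rule eq_reflection, rule sum.neutral[symmetric], rule ballI)
      fix p assume "p \<in> I"
      then show "expectation (X p) = 0"
        using k unfolding X_def by (intro integral_draw_coordinate) (auto simp: I_def)
    qed
  qed
  have sq: "(\<Sum>p\<in>I. (1 - (-1 :: real))\<^sup>2) = 4 * N" by (simp add: I_def)
  have sum: "(\<Sum>p\<in>I. X p \<omega>) = (\<Sum>i=1..N. y k i \<omega> $ c)" for \<omega>
    unfolding I_def sum.cartesian_product' by (simp add: X_def)
  have "prob {\<omega> \<in> space M. \<bar>(\<Sum>p\<in>I. X p \<omega>) - 0\<bar> \<ge> N * \<epsilon>} \<le> 2 * exp (-2 * (N * \<epsilon>)\<^sup>2 / (4 * N))"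
    using Hoeffding_ineq_abs_ge[of "N * \<epsilon>"] \<epsilon> N unfolding sq by simp
  also have "-2 * (N * \<epsilon>)\<^sup>2 / (4 * N) = - (\<epsilon>\<^sup>2 / 2) * N"
    using N by (simp add: power2_eq_square)
  finally show ?thesis by (simp add: sum)
qed

end

section \<open>Recovery with high probability\<close>

context
  fixes M :: "'a measure" and D :: "(real ^ 'm) measure" and N :: nat
    and y :: "nat \<Rightarrow> nat \<Rightarrow> 'a \<Rightarrow> real ^ 'm" and \<gamma> :: "nat \<Rightarrow> real ^ 'm"
  assumes D: "ball_distribution D" and draws: "sbm_draws M D N y" and N: "N > 0"
begin

lemma sets_recovery_event:
  "{\<omega> \<in> space M. lp2_recovers (2 * N) (sq_dist (sbm_point \<gamma> N y \<omega>))} \<in> sets M"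
proof (rule sets_lp2_recovers[OF lp2_feasible_planted[OF N]])
  have point: "(\<lambda>\<omega>. sbm_point \<gamma> N y \<omega> i) \<in> borel_measurable M" if "i \<in> {1..2 * N}" for i
  proof (cases "i \<le> N")
    case True
    then have "y 1 i \<in> borel_measurable M" using that by (intro measurable_draw[OF D draws]) auto
    then show ?thesis using True by (simp add: sbm_point_def)
  next
    case False
    then have "y 2 (i - N) \<in> borel_measurable M" using that by (intro measurable_draw[OF D draws]) auto
    then show ?thesis using False by (simp add: sbm_point_def)
  qed
  show "(\<lambda>\<omega>. sq_dist (sbm_point \<gamma> N y \<omega>) i j) \<in> borel_measurable M"
    if "i \<in> {1..2 * N}" "j \<in> {1..2 * N}" for i j
    unfolding sq_dist_def using point[OF that(1)] point[OF that(2)] by measurable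
qed

text \<open>If the empirical means of the draws have norm at most \<open>\<eta>\<close>, the points lie within \<open>1 + \<eta>\<close> of the
centroids of their clusters, and the centroids are at least \<open>norm (\<gamma> 1 - \<gamma> 2) - 2 * \<eta>\<close> apart. The factor 5
covers this loss of \<open>2 * \<eta>\<close> and the increase of \<open>(1 + sqrt 3) * \<eta>\<close> in the threshold, as
\<open>3 + sqrt 3 \<le> 5\<close>.\<close>

lemma recovery_if_means_small:
  assumes bounded: "\<And>k i. k \<in> {1, 2} \<Longrightarrow> i \<in> {1..N} \<Longrightarrow> norm (y k i \<omega>) \<le> 1"
    and mean: "\<And>k. k \<in> {1, 2} \<Longrightarrow> norm ((\<Sum>i=1..N. y k i \<omega>) /\<^sub>R N) \<le> \<eta>"
    and sep: "norm (\<gamma> 1 - \<gamma> 2) > 1 + sqrt 3 + 5 * \<eta>"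
  shows "lp2_recovers (2 * N) (sq_dist (sbm_point \<gamma> N y \<omega>))"
proof (rule lp2_recovers_if_separated[OF N, where R = "1 + \<eta>"])
  define m where "m k = (\<Sum>i=1..N. y k i \<omega>) /\<^sub>R N" for k
  let ?x = "sbm_point \<gamma> N y \<omega>"
  have Nm: "(\<Sum>i=1..N. y k i \<omega>) = N *\<^sub>R m k" for k using N by (simp add: m_def)
  have x1: "?x i - (m 1 + \<gamma> 1) = y 1 i \<omega> - m 1" if "i \<in> {1..N}" for i
    using that by (simp add: sbm_point_def)
  have x2: "?x i - (m 2 + \<gamma> 2) = y 2 (i - N) \<omega> - m 2" if "i \<in> {N + 1..2 * N}" for i
    using that by (simp add: sbm_point_def)
  have centred: "(\<Sum>i=1..N. y k i \<omega> - m k) = 0" for k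
    using Nm[of k] by (simp add: sum_subtractf sum_constant_scaleR del: sum_constant)
  have "(\<Sum>i=1..N. ?x i - (m 1 + \<gamma> 1)) = (\<Sum>i=1..N. y 1 i \<omega> - m 1)"
    by (rule sum.cong[OF refl x1])
  then show "(\<Sum>i=1..N. ?x i - (m 1 + \<gamma> 1)) = 0" by (simp only: centred)
  have "(\<Sum>i=N + 1..2 * N. ?x i - (m 2 + \<gamma> 2)) = (\<Sum>i=N + 1..2 * N. y 2 (i - N) \<omega> - m 2)"
    by (rule sum.cong[OF refl x2])
  also have "\<dots> = (\<Sum>i=1..N. y 2 i \<omega> - m 2)"
    by (rule sum.reindex_bij_witness[where i = "\<lambda>i. i + N" and j = "\<lambda>i. i - N"]) auto
  finally show "(\<Sum>i=N + 1..2 * N. ?x i - (m 2 + \<gamma> 2)) = 0" by (simp only: centred)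
  have m: "norm (m 1) \<le> \<eta>" "norm (m 2) \<le> \<eta>" using mean by (auto simp: m_def)
  show "norm (?x i - (m 1 + \<gamma> 1)) \<le> 1 + \<eta>" if "i \<in> {1..N}" for i
    unfolding x1[OF that] using bounded[of 1 i] that m norm_triangle_ineq4[of "y 1 i \<omega>" "m 1"] by simp
  show "norm (?x i - (m 2 + \<gamma> 2)) \<le> 1 + \<eta>" if "i \<in> {N + 1..2 * N}" for i
  proof -
    have "i - N \<in> {1..N}" using that by auto
    then show ?thesis
      unfolding x2[OF that] using bounded[of 2 "i - N"] m norm_triangle_ineq4[of "y 2 (i - N) \<omega>" "m 2"] by simp
  qed
  have "norm (\<gamma> 1 - \<gamma> 2) \<le> norm (m 1 + \<gamma> 1 - (m 2 + \<gamma> 2)) + norm (m 1) + norm (m 2)"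
    using norm_triangle_ineq4[of "m 1 + \<gamma> 1 - (m 2 + \<gamma> 2)" "m 1 - m 2"] norm_triangle_ineq4[of "m 1" "m 2"]
    by (simp add: algebra_simps)
  moreover have "sqrt 3 * \<eta> \<le> 2 * \<eta>"
  proof (rule mult_right_mono)
    show "sqrt 3 \<le> 2" by (rule real_le_lsqrt) auto
    show "0 \<le> \<eta>" using m norm_ge_zero order_trans by blast
  qed
  ultimately show "(1 + sqrt 3) * (1 + \<eta>) < norm (m 1 + \<gamma> 1 - (m 2 + \<gamma> 2))"
    using sep m by (simp add: algebra_simps)
qed

text \<open>If every coordinate of both empirical means is below \<open>\<eta> / CARD('m)\<close>, the means have norm at most \<open>\<eta>\<close>.
There are \<open>2 * CARD('m)\<close> such coordinates, and a union bound applies.\<close>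

lemma prob_recovery_ge:
  assumes \<eta>: "\<eta> > 0" and sep: "norm (\<gamma> 1 - \<gamma> 2) > 1 + sqrt 3 + 5 * \<eta>"
  defines "\<epsilon> \<equiv> \<eta> / CARD('m)"
  shows "measure M {\<omega> \<in> space M. lp2_recovers (2 * N) (sq_dist (sbm_point \<gamma> N y \<omega>))}
    \<ge> 1 - 4 * real CARD('m) * exp (- (\<epsilon>\<^sup>2 / 2) * N)"
proof -
  interpret prob_space M using draws by (simp add: sbm_draws_def)
  define J :: "(nat \<times> 'm) set" where "J = {1, 2} \<times> UNIV"
  define good where "good = {\<omega> \<in> space M. lp2_recovers (2 * N) (sq_dist (sbm_point \<gamma> N y \<omega>))}"
  define bad where "bad p = {\<omega> \<in> space M. \<bar>\<Sum>i=1..N. y (fst p) i \<omega> $ snd p\<bar> \<ge> N * \<epsilon>}" for p :: "nat \<times> 'm"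
  have \<epsilon>: "\<epsilon> > 0" using \<eta> by (simp add: \<epsilon>_def)
  have good: "good \<in> events" unfolding good_def by (rule sets_recovery_event)
  have bad: "bad p \<in> events" if "p \<in> J" for p
  proof -
    have "(\<lambda>\<omega>. y (fst p) i \<omega> $ snd p) \<in> borel_measurable M" if "i \<in> {1..N}" for i
      using that \<open>p \<in> J\<close>
      by (intro measurable_compose[OF measurable_draw[OF D draws] borel_measurable_nth]) (auto simp: J_def)
    then show ?thesis unfolding bad_def by measurable
  qed
  have "AE \<omega> in M. \<forall>p\<in>{1, 2} \<times> {1..N}. norm (y (fst p) (snd p) \<omega>) \<le> 1"
    by (rule AE_finite_allI) (auto intro!: AE_draw_bounded[OF D draws])
  then have "AE \<omega> in M. \<omega> \<in> good \<union> (\<Union>p\<in>J. bad p)"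
  proof (rule AE_mp, intro AE_I2 impI)
    fix \<omega> assume \<omega>: "\<omega> \<in> space M" and b: "\<forall>p\<in>{1, 2} \<times> {1..N}. norm (y (fst p) (snd p) \<omega>) \<le> 1"
    show "\<omega> \<in> good \<union> (\<Union>p\<in>J. bad p)"
    proof (cases "\<omega> \<in> (\<Union>p\<in>J. bad p)")
      case False
      have coord: "\<bar>\<Sum>i=1..N. y k i \<omega> $ c\<bar> \<le> N * \<epsilon>" if "k \<in> {1, 2}" for k c
      proof -
        have "(k, c) \<in> J" using that by (simp add: J_def)
        then have "\<omega> \<notin> bad (k, c)" using False by blast
        then show ?thesis using \<omega> by (simp add: bad_def)
      qed
      have "norm ((\<Sum>i=1..N. y k i \<omega>) /\<^sub>R N) \<le> \<eta>" if k: "k \<in> {1, 2}" for k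
      proof -
        have "norm ((\<Sum>i=1..N. y k i \<omega>) /\<^sub>R N) \<le> (\<Sum>c\<in>UNIV. \<bar>((\<Sum>i=1..N. y k i \<omega>) /\<^sub>R N) $ c\<bar>)"
          by (rule norm_le_l1_cart)
        also have "\<dots> \<le> (\<Sum>c\<in>(UNIV :: 'm set). \<epsilon>)"
          using coord[OF k] N by (intro sum_mono) (simp add: abs_mult field_simps)
        also have "\<dots> = \<eta>" by (simp add: \<epsilon>_def)
        finally show ?thesis .
      qed
      moreover have "norm (y k i \<omega>) \<le> 1" if "k \<in> {1, 2}" "i \<in> {1..N}" for k i
        using bspec[OF b, of "(k, i)"] that by simp
      ultimately have "lp2_recovers (2 * N) (sq_dist (sbm_point \<gamma> N y \<omega>))"
        by (intro recovery_if_means_small[where \<eta> = \<eta>] sep)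
      then have "\<omega> \<in> good" using \<omega> by (simp add: good_def)
      then show ?thesis by simp
    qed simp
  qed
  moreover have "good \<union> (\<Union>p\<in>J. bad p) \<in> events"
    using good bad by (intro sets.Un sets.finite_UN) (auto simp: J_def)
  ultimately have "prob (good \<union> (\<Union>p\<in>J. bad p)) = 1"
    by (simp only: prob_eq_1)
  then have "1 = prob (good \<union> (\<Union>p\<in>J. bad p))" by (rule sym)
  also have "\<dots> \<le> prob good + prob (\<Union>p\<in>J. bad p)"
    using good bad by (intro measure_Un_le sets.finite_UN) (auto simp: J_def)
  finally have "1 \<le> prob good + prob (\<Union>p\<in>J. bad p)" .
  moreover have "prob (\<Union>p\<in>J. bad p) \<le> (\<Sum>p\<in>J. prob (bad p))"
    using bad by (intro measure_UNION_le) (auto simp: J_def)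
  moreover have "(\<Sum>p\<in>J. prob (bad p)) \<le> (\<Sum>p\<in>J. 2 * exp (- (\<epsilon>\<^sup>2 / 2) * N))"
    unfolding bad_def
    by (intro sum_mono prob_coordinate_sum_ge[OF D draws _ \<epsilon> N]) (auto simp: J_def)
  moreover have "(\<Sum>p\<in>J. 2 * exp (- (\<epsilon>\<^sup>2 / 2) * N)) = 4 * real CARD('m) * exp (- (\<epsilon>\<^sup>2 / 2) * N)"
    by (simp add: J_def card_cartesian_product)
  ultimately show ?thesis by (simp add: good_def)
qed

end

theorem theorem3:
  fixes M :: "nat \<Rightarrow> 'a measure"
    and D :: "(real ^ 'm) measure"
    and y :: "nat \<Rightarrow> nat \<Rightarrow> nat \<Rightarrow> 'a \<Rightarrow> real ^ 'm"
    and \<gamma> :: "nat \<Rightarrow> real ^ 'm"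
    and \<Delta> :: real
  assumes "ball_distribution D"
    and "\<And>N. sbm_draws (M N) D N (y N)"
    and "\<Delta> = norm (\<gamma> 1 - \<gamma> 2)"
    and "\<Delta> > 1 + sqrt 3"
  shows "(\<lambda>N. measure (M N) {\<omega> \<in> space (M N).
            lp2_recovers (2 * N) (sq_dist (sbm_point \<gamma> N (y N) \<omega>))}) \<longlonglongrightarrow> 1"
proof -
  define \<eta> where "\<eta> = (\<Delta> - (1 + sqrt 3)) / 6"
  have \<eta>: "\<eta> > 0" using assms(4) by (simp add: \<eta>_def)
  have sep: "norm (\<gamma> 1 - \<gamma> 2) > 1 + sqrt 3 + 5 * \<eta>"
    using \<eta> unfolding assms(3)[symmetric] by (simp add: \<eta>_def field_simps)
  define c where "c = (\<eta> / CARD('m))\<^sup>2 / 2"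
  have c: "c > 0" using \<eta> by (simp add: c_def)
  have "(\<lambda>N::nat. 1 - 4 * real CARD('m) * exp (- c * N)) \<longlonglongrightarrow> 1 - 4 * real CARD('m) * 0"
  proof (intro tendsto_intros)
    have "(\<lambda>N::nat. exp (- c) ^ N) \<longlonglongrightarrow> 0"
      using c by (intro LIMSEQ_realpow_zero) auto
    then show "(\<lambda>N::nat. exp (- c * N)) \<longlonglongrightarrow> 0"
      by (simp only: exp_of_nat2_mult)
  qed
  then have lower: "(\<lambda>N::nat. 1 - 4 * real CARD('m) * exp (- c * N)) \<longlonglongrightarrow> 1" by simp
  show ?thesis
  proof (rule tendsto_sandwich[OF _ _ lower tendsto_const])
    show "\<forall>\<^sub>F N in sequentially. 1 - 4 * real CARD('m) * exp (- c * N) \<le> measure (M N) {\<omega> \<in> space (M N).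
            lp2_recovers (2 * N) (sq_dist (sbm_point \<gamma> N (y N) \<omega>))}"
      using eventually_gt_at_top[of 0]
    proof eventually_elim
      case (elim N)
      then show ?case
        using prob_recovery_ge[OF assms(1,2) elim \<eta> sep] by (simp add: c_def)
    qed
    show "\<forall>\<^sub>F N in sequentially. measure (M N) {\<omega> \<in> space (M N).
            lp2_recovers (2 * N) (sq_dist (sbm_point \<gamma> N (y N) \<omega>))} \<le> 1"
      using assms(2) by (auto simp: sbm_draws_def intro!: always_eventually prob_space.prob_le_1)
  qed
qed

end
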